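(* Let $A_0$ and $A_1$ be r.i. quasi-Banach function spaces (over a common nonatomic $\sigma$-finite measure space $(\mathcal R,\mu)$) that admit, respectively, the representation spaces $\overline A_0$ and $\overline A_1$ over $(0,\infty)$. For $i\in\{0,1\}$ let $\varphi_i(t)=\|\chi_{(0,t)}\|_{\overline A_i}$ for $t\in(0,\infty)$, and set $\sigma=\varphi_0/\varphi_1$. Suppose that $$\left\|\chi_{(0,t)}(s)\,g^*(\tfrac s2)\right\|_{\overline A_0}\lesssim\sigma(t)\,\|g^*\|_{\overline A_1}\quad\text{for all }t\in(0,\infty)\text{ and }g\in A_1,$$ and $$\sigma(t)\left\|\chi_{(t,\infty)}(s)\,h^*(\tfrac s2)\right\|_{\overline A_1}\lesssim\|h^*\|_{\overline A_0}\quad\text{for all }t\in(0,\infty)\text{ and }h\in A_0,$$ with constants in $\lesssim$ independent of $g$, $h$ and $t$ (the norms on the left being taken with respect to the variable $s$). Then $$K(f,\sigma(t);A_0,A_1)\approx\|\chi_{(0,t)}f^*\|_{\overline A_0}+\sigma(t)\,\|\chi_{(t,\infty)}f^*\|_{\overline A_1}$$ for all $f\in A_0+A_1$ and $t\in(0,\infty)$, with constants of equivalence independent of $f$ and $t$.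
   Context: $(\mathcal R,\mu)$ is a nonatomic $\sigma$-finite measure space with $\mu(\mathcal R)\in(0,\infty]$; $\mathcal M$ is the set of $\mu$-measurable functions $\mathcal R\to[-\infty,\infty]$ and $\mathcal M_+$ the subset of those with values in $[0,\infty]$. The non-increasing rearrangement of $f\in\mathcal M$ is $f^*(t)=\inf\{\lambda\ge0:\mu(\{|f|>\lambda\})\le t\}$. A quasi-Banach function norm is a map $\|\cdot\|\colon\mathcal M\to[0,\infty]$ with $\|\,|f|\,\|=\|f\|$ whose restriction to $\mathcal M_+$ satisfies: positive homogeneity; $\|f\|=0\iff f=0$ a.e.; $\|f+g\|\le C(\|f\|+\|g\|)$ for some constant $C$; the lattice property ($f\le g$ a.e. implies $\|f\|\le\|g\|$); the Fatou property ($f_n\uparrow f$ a.e. implies $\|f_n\|\uparrow\|f\|$); and $\|\chi_E\|<\infty$ whenever $\mu(E)<\infty$. It is rearrangement-invariant (r.i.) if $\|f\|=\|g\|$ whenever $f^*=g^*$. The corresponding r.i. quasi-Banach function space is $X=\{f\in\mathcal M:\|f\|_X<\infty\}$. A representation space $\overline X$ of $X$ is given by an r.i. quasi-Banach function norm $\|\cdot\|_{\overline X}$ on measurable functions on $(0,\infty)$ with Lebesgue measure such that $\|f\|_X=\|f^*\|_{\overline X}$ for all $f\in\mathcal M$. $A_0+A_1$ is the set of $f\in\mathcal M$ that can be written as $f=f_0+f_1$ with $f_i\in A_i$, and $K(f,t;A_0,A_1)=\inf\{\|f_0\|_{A_0}+t\|f_1\|_{A_1}: f=f_0+f_1,\ f_i\in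 A_i\}$. $\lesssim$ means $\le$ up to a positive multiplicative constant; $\approx$ means $\lesssim$ in both directions. *)

theory Defs
  imports "HOL-Analysis.Analysis"
begin

definition nonatomic :: "'a measure \<Rightarrow> bool" where
  "nonatomic M \<longleftrightarrow>
     (\<forall>A\<in>sets M. 0 < emeasure M A \<longrightarrow>
        (\<exists>B\<in>sets M. B \<subseteq> A \<and> 0 < emeasure M B \<and> emeasure M B < emeasure M A))"

text \<open>The measurable functions into the extended real line are \<open>borel_measurable M\<close> at
  type \<open>ereal\<close>; the values outside \<open>space M\<close> play no role.\<close>

definition nonneg_measurable :: "'a measure \<Rightarrow> ('a \<Rightarrow> ereal) set" where
  "nonneg_measurable M = {f \<in> borel_measurable M. \<forall>x\<in>space M. 0 \<le> f x}"

text \<open>The infimum is taken in \<open>ereal\<close>, so it is \<open>\<infinity>\<close> if no finite level \<open>l\<close> qualifies.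
  Only the values at \<open>t > 0\<close> are ever used.\<close>

definition rearrangement :: "'a measure \<Rightarrow> ('a \<Rightarrow> ereal) \<Rightarrow> real \<Rightarrow> ereal" where
  "rearrangement M f t =
     (INF l\<in>{l::real. 0 \<le> l \<and> emeasure M {x \<in> space M. ereal l < \<bar>f x\<bar>} \<le> ennreal t}. ereal l)"

definition quasi_banach_function_norm :: "'a measure \<Rightarrow> (('a \<Rightarrow> ereal) \<Rightarrow> ennreal) \<Rightarrow> bool" where
  "quasi_banach_function_norm M N \<longleftrightarrow>
     (\<forall>f\<in>borel_measurable M. N (\<lambda>x. \<bar>f x\<bar>) = N f) \<and>
     (\<forall>f\<in>nonneg_measurable M. \<forall>a::real. 0 \<le> a \<longrightarrow> N (\<lambda>x. ereal a * f x) = ennreal a * N f) \<and>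
     (\<forall>f\<in>nonneg_measurable M. N f = 0 \<longleftrightarrow> (AE x in M. f x = 0)) \<and>
     (\<exists>C::real. 0 < C \<and> (\<forall>f\<in>nonneg_measurable M. \<forall>g\<in>nonneg_measurable M.
        N (\<lambda>x. f x + g x) \<le> ennreal C * (N f + N g))) \<and>
     (\<forall>f\<in>nonneg_measurable M. \<forall>g\<in>nonneg_measurable M.
        (AE x in M. f x \<le> g x) \<longrightarrow> N f \<le> N g) \<and>
     (\<forall>F f. (\<forall>n::nat. F n \<in> nonneg_measurable M) \<longrightarrow> f \<in> nonneg_measurable M \<longrightarrow>
        (AE x in M. incseq (\<lambda>n. F n x) \<and> (\<lambda>n. F n x) \<longlonglongrightarrow> f x) \<longrightarrow>
        incseq (\<lambda>n. N (F n)) \<and> (\<lambda>n. N (F n)) \<longlonglongrightarrow> N f) \<and>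
     (\<forall>E\<in>sets M. emeasure M E < \<infinity> \<longrightarrow> N (indicator E) < \<infinity>)"

definition ri_quasi_banach_function_norm :: "'a measure \<Rightarrow> (('a \<Rightarrow> ereal) \<Rightarrow> ennreal) \<Rightarrow> bool" where
  "ri_quasi_banach_function_norm M N \<longleftrightarrow>
     quasi_banach_function_norm M N \<and>
     (\<forall>f\<in>borel_measurable M. \<forall>g\<in>borel_measurable M.
        (\<forall>t>0. rearrangement M f t = rearrangement M g t) \<longrightarrow> N f = N g)"

text \<open>A function space is represented by its norm \<open>N\<close>.\<close>

definition function_space :: "'a measure \<Rightarrow> (('a \<Rightarrow> ereal) \<Rightarrow> ennreal) \<Rightarrow> ('a \<Rightarrow> ereal) set" where
  "function_space M N = {f \<in> borel_measurable M. N f < \<infinity>}"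

definition representation_norm ::
  "'a measure \<Rightarrow> (('a \<Rightarrow> ereal) \<Rightarrow> ennreal) \<Rightarrow> ((real \<Rightarrow> ereal) \<Rightarrow> ennreal) \<Rightarrow> bool" where
  "representation_norm M N R \<longleftrightarrow>
     ri_quasi_banach_function_norm (lebesgue_on {0<..}) R \<and>
     (\<forall>f\<in>borel_measurable M. N f = R (rearrangement M f))"

text \<open>Decompositions are understood almost everywhere. Members of a quasi-Banach function space
  are finite almost everywhere, so the undefined sums \<open>\<infinity> + (-\<infinity>)\<close> occur only on null sets.\<close>

definition decompositions ::
  "'a measure \<Rightarrow> (('a \<Rightarrow> ereal) \<Rightarrow> ennreal) \<Rightarrow> (('a \<Rightarrow> ereal) \<Rightarrow> ennreal) \<Rightarrow> ('a \<Rightarrow> ereal)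
     \<Rightarrow> (('a \<Rightarrow> ereal) \<times> ('a \<Rightarrow> ereal)) set" where
  "decompositions M N0 N1 f =
     {(f0, f1). f0 \<in> function_space M N0 \<and> f1 \<in> function_space M N1 \<and>
                (AE x in M. f x = f0 x + f1 x)}"

definition sum_space ::
  "'a measure \<Rightarrow> (('a \<Rightarrow> ereal) \<Rightarrow> ennreal) \<Rightarrow> (('a \<Rightarrow> ereal) \<Rightarrow> ennreal) \<Rightarrow> ('a \<Rightarrow> ereal) set" where
  "sum_space M N0 N1 = {f \<in> borel_measurable M. decompositions M N0 N1 f \<noteq> {}}"

definition K_functional ::
  "'a measure \<Rightarrow> (('a \<Rightarrow> ereal) \<Rightarrow> ennreal) \<Rightarrow> (('a \<Rightarrow> ereal) \<Rightarrow> ennreal) \<Rightarrow> ('a \<Rightarrow> ereal)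
     \<Rightarrow> ennreal \<Rightarrow> ennreal" where
  "K_functional M N0 N1 f t = (INF (f0, f1)\<in>decompositions M N0 N1 f. N0 f0 + t * N1 f1)"

definition fundamental_function :: "((real \<Rightarrow> ereal) \<Rightarrow> ennreal) \<Rightarrow> real \<Rightarrow> ennreal" where
  "fundamental_function R t = R (indicator {0<..<t})"

end

theory Submission imports Defs begin

text \<open>For the upper bound, cut \<open>f\<close> at the level \<open>a = f\<^sup>*(t)\<close>: the part above the level has
  rearrangement at most \<open>\<chi>\<^bsub>(0,t)\<^esub> f\<^sup>*\<close>, the truncation has rearrangement at most
  \<open>a \<chi>\<^bsub>(0,t)\<^esub> + \<chi>\<^bsub>(t,\<infinity>)\<^esub> f\<^sup>*\<close> almost everywhere, and \<open>\<sigma>(t) a \<phi>\<^sub>1(t) = a \<phi>\<^sub>0(t)\<close> is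
  absorbed by the norm of \<open>\<chi>\<^bsub>(0,t)\<^esub> f\<^sup>*\<close>. For the lower bound, a decomposition \<open>f = f\<^sub>0 + f\<^sub>1\<close> gives
  \<open>f\<^sup>*(s) \<le> f\<^sub>0\<^sup>*(s/2) + f\<^sub>1\<^sup>*(s/2)\<close>; of the four resulting terms the two hypotheses control the
  mixed ones, and the boundedness of the dilation \<open>g \<mapsto> g(\<cdot>/2)\<close> on r.i. spaces the other two. The
  dilation is bounded because \<open>g(\<cdot>/2)\<close> is equimeasurable with the sum of two disjointly supported
  copies of \<open>g\<close>.\<close>

section \<open>Distribution functions and rearrangements\<close>

definition distribution_function :: "'a measure \<Rightarrow> ('a \<Rightarrow> ereal) \<Rightarrow> real \<Rightarrow> ennreal" where
  "distribution_function M f l = emeasure M {x \<in> space M. ereal l < \<bar>f x\<bar>}"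

lemma distribution_function_mono:
  assumes [measurable]: "g \<in> borel_measurable M" and "AE x in M. \<bar>f x\<bar> \<le> \<bar>g x\<bar>"
  shows "distribution_function M f l \<le> distribution_function M g l"
  unfolding distribution_function_def
  using assms(2) by (intro emeasure_mono_AE) (auto elim: eventually_mono)

lemma distribution_function_antimono:
  assumes [measurable]: "f \<in> borel_measurable M" and "k \<le> l"
  shows "distribution_function M f l \<le> distribution_function M f k"
  unfolding distribution_function_def
  using assms(2) by (intro emeasure_mono) (auto intro: le_less_trans[of "ereal k" "ereal l"])

lemma ereal_less_iff_Ex_inverse_Suc:
  "ereal l < y \<longleftrightarrow> (\<exists>n. ereal (l + inverse (real (Suc n))) < y)"
proof
  assume "ereal l < y"
  then obtain b where b: "ereal l < ereal b" "ereal b < y" using ereal_dense2 by blast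
  then obtain n where "inverse (real (Suc n)) < b - l" using reals_Archimedean[of "b - l"] by auto
  then have "ereal (l + inverse (real (Suc n))) < ereal b" by simp
  also note b(2)
  finally show "\<exists>n. ereal (l + inverse (real (Suc n))) < y" ..
next
  assume "\<exists>n. ereal (l + inverse (real (Suc n))) < y"
  then obtain n where "ereal (l + inverse (real (Suc n))) < y" ..
  moreover have "ereal l \<le> ereal (l + inverse (real (Suc n)))" by simp
  ultimately show "ereal l < y" by (rule le_less_trans[rotated])
qed

lemma distribution_function_right_continuous:
  assumes [measurable]: "f \<in> borel_measurable M"
  shows "distribution_function M f l
    = (SUP n. distribution_function M f (l + inverse (real (Suc n))))"
proof -
  let ?E = "\<lambda>n. {x \<in> space M. ereal (l + inverse (real (Suc n))) < \<bar>f x\<bar>}"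
  have "incseq ?E"
  proof (rule incseq_SucI, clarify)
    fix n x assume "ereal (l + inverse (real (Suc n))) < \<bar>f x\<bar>"
    moreover have "ereal (l + inverse (real (Suc (Suc n)))) \<le> ereal (l + inverse (real (Suc n)))"
      by (simp add: field_simps)
    ultimately show "ereal (l + inverse (real (Suc (Suc n)))) < \<bar>f x\<bar>"
      by (rule le_less_trans[rotated])
  qed
  moreover have "{x \<in> space M. ereal l < \<bar>f x\<bar>} = (\<Union>n. ?E n)"
    by (auto simp only: ereal_less_iff_Ex_inverse_Suc[of l])
  moreover have "range ?E \<subseteq> sets M" by auto
  ultimately show ?thesis
    unfolding distribution_function_def using SUP_emeasure_incseq[of ?E M] by simp
qed

lemma distribution_function_add_le:
  assumes [measurable]: "g \<in> borel_measurable M" "h \<in> borel_measurable M"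
    and sum: "AE x in M. f x = g x + h x"
  shows "distribution_function M f (a + b)
    \<le> distribution_function M g a + distribution_function M h b"
proof -
  let ?G = "{x \<in> space M. ereal a < \<bar>g x\<bar>}" and ?H = "{x \<in> space M. ereal b < \<bar>h x\<bar>}"
  have "AE x in M. x \<in> {x \<in> space M. ereal (a + b) < \<bar>f x\<bar>} \<longrightarrow> x \<in> ?G \<union> ?H"
    using sum
  proof eventually_elim
    case (elim x)
    have "\<bar>f x\<bar> \<le> \<bar>g x\<bar> + \<bar>h x\<bar>" unfolding elim by (cases "g x"; cases "h x") auto
    moreover have "\<bar>g x\<bar> + \<bar>h x\<bar> \<le> ereal (a + b)" if "\<bar>g x\<bar> \<le> ereal a" "\<bar>h x\<bar> \<le> ereal b"
      using add_mono[OF that] by simp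
    ultimately show ?case by (auto simp: not_less dest: order_trans)
  qed
  then have "distribution_function M f (a + b) \<le> emeasure M (?G \<union> ?H)"
    unfolding distribution_function_def by (intro emeasure_mono_AE) measurable
  also have "\<dots> \<le> distribution_function M g a + distribution_function M h b"
    unfolding distribution_function_def by (rule emeasure_subadditive) auto
  finally show ?thesis .
qed

lemma distribution_function_add_disjoint:
  assumes [measurable]: "f \<in> borel_measurable M" "g \<in> borel_measurable M"
    and disjoint: "\<And>x. x \<in> space M \<Longrightarrow> f x = 0 \<or> g x = 0" and "0 \<le> l"
  shows "distribution_function M (\<lambda>x. f x + g x) l
    = distribution_function M f l + distribution_function M g l"
proof -
  let ?F = "{x \<in> space M. ereal l < \<bar>f x\<bar>}" and ?G = "{x \<in> space M. ereal l < \<bar>g x\<bar>}"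
  have "{x \<in> space M. ereal l < \<bar>f x + g x\<bar>} = ?F \<union> ?G" "?F \<inter> ?G = {}"
    using disjoint \<open>0 \<le> l\<close> by fastforce+
  then show ?thesis
    unfolding distribution_function_def by (simp add: plus_emeasure)
qed

lemma rearrangement_eq_INF:
  "rearrangement M f t = (INF l\<in>{l. 0 \<le> l \<and> distribution_function M f l \<le> ennreal t}. ereal l)"
  unfolding rearrangement_def distribution_function_def ..

lemma rearrangement_nonneg: "0 \<le> rearrangement M f t"
  unfolding rearrangement_def by (rule INF_greatest) auto

lemma rearrangement_antimono: "antimono (rearrangement M f)"
  unfolding rearrangement_def
  by (intro antimonoI INF_superset_mono) (auto intro: order_trans ennreal_leI)

lemma borel_measurable_antimono:
  fixes f :: "real \<Rightarrow> 'b::{second_countable_topology, linorder_topology}"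
  assumes "antimono f"
  shows "f \<in> borel_measurable borel"
proof (rule borel_measurableI_greater)
  fix y
  have "is_interval {x. y < f x}"
    unfolding is_interval_1 by (auto intro: less_le_trans antimonoD[OF assms])
  then show "{x \<in> space borel. y < f x} \<in> sets borel"
    using real_interval_borel_measurable by simp
qed

lemmas borel_measurable_rearrangement [measurable] =
  borel_measurable_antimono[OF rearrangement_antimono]

lemma rearrangement_mono:
  assumes "g \<in> borel_measurable M" "AE x in M. \<bar>f x\<bar> \<le> \<bar>g x\<bar>"
  shows "rearrangement M f t \<le> rearrangement M g t"
  unfolding rearrangement_eq_INF
  by (intro INF_superset_mono) (auto intro: order_trans distribution_function_mono[OF assms])

lemma rearrangement_cong:
  assumes "\<And>l. 0 \<le> l \<Longrightarrow> distribution_function M f l = distribution_function N g l"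
  shows "rearrangement M f = rearrangement N g"
  unfolding rearrangement_eq_INF using assms by (intro ext INF_cong) auto

lemma rearrangement_le_iff:
  assumes f: "f \<in> borel_measurable M" and "0 \<le> l"
  shows "rearrangement M f t \<le> ereal l \<longleftrightarrow> distribution_function M f l \<le> ennreal t"
proof
  assume "distribution_function M f l \<le> ennreal t"
  then show "rearrangement M f t \<le> ereal l"
    unfolding rearrangement_eq_INF using \<open>0 \<le> l\<close> by (intro INF_lower) simp
next
  assume le: "rearrangement M f t \<le> ereal l"
  have "distribution_function M f (l + inverse (real (Suc n))) \<le> ennreal t" for n
  proof -
    have "rearrangement M f t < ereal (l + inverse (real (Suc n)))"
      using le by (rule le_less_trans) simp
    then obtain k where "k < l + inverse (real (Suc n))" "distribution_function M f k \<le> ennreal t"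
      unfolding rearrangement_eq_INF INF_less_iff by auto
    then show ?thesis
      using distribution_function_antimono[OF f] by (meson less_imp_le order_trans)
  qed
  then show "distribution_function M f l \<le> ennreal t"
    unfolding distribution_function_right_continuous[OF f, of l] by (intro SUP_least)
qed

lemma rearrangement_add_le:
  assumes meas: "f \<in> borel_measurable M" "g \<in> borel_measurable M" "h \<in> borel_measurable M"
    and sum: "AE x in M. f x = g x + h x" and "0 \<le> s" "0 \<le> t"
  shows "rearrangement M f (s + t) \<le> rearrangement M g s + rearrangement M h t"
proof (cases "rearrangement M g s = \<infinity> \<or> rearrangement M h t = \<infinity>")
  case True
  then show ?thesis
    using rearrangement_nonneg[of M g s] rearrangement_nonneg[of M h t] by auto
next
  case False
  then obtain a b where a: "rearrangement M g s = ereal a" "0 \<le> a"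
    and b: "rearrangement M h t = ereal b" "0 \<le> b"
    using rearrangement_nonneg[of M g s] rearrangement_nonneg[of M h t]
    by (cases "rearrangement M g s"; cases "rearrangement M h t") auto
  have "distribution_function M f (a + b)
      \<le> distribution_function M g a + distribution_function M h b"
    by (rule distribution_function_add_le[OF meas(2,3) sum])
  also have "\<dots> \<le> ennreal s + ennreal t"
    using a b rearrangement_le_iff[OF meas(2), of a s] rearrangement_le_iff[OF meas(3), of b t]
    by (intro add_mono) simp_all
  also have "\<dots> = ennreal (s + t)" using \<open>0 \<le> s\<close> \<open>0 \<le> t\<close> by simp
  finally show ?thesis
    unfolding a b using a(2) b(2) by (simp add: rearrangement_le_iff[OF meas(1)])
qed

section \<open>Truncation\<close>

definition truncation :: "real \<Rightarrow> ('a \<Rightarrow> ereal) \<Rightarrow> 'a \<Rightarrow> ereal" where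
  "truncation a f x = max (- ereal a) (min (ereal a) (f x))"

lemma borel_measurable_truncation [measurable]:
  assumes [measurable]: "f \<in> borel_measurable M"
  shows "truncation a f \<in> borel_measurable M"
  unfolding truncation_def by measurable

lemma minus_truncation_add: "f x - truncation a f x + truncation a f x = f x"
  unfolding truncation_def by (cases "f x") (auto simp: max_def min_def)

lemma abs_truncation: "0 \<le> a \<Longrightarrow> \<bar>truncation a f x\<bar> = min (ereal a) \<bar>f x\<bar>"
  unfolding truncation_def by (cases "f x") (auto simp: max_def min_def)

lemma abs_minus_truncation: "0 \<le> a \<Longrightarrow> \<bar>f x - truncation a f x\<bar> = max 0 (\<bar>f x\<bar> - ereal a)"
  unfolding truncation_def by (cases "f x") (auto simp: max_def min_def)

lemma distribution_function_minus_truncation: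
  assumes "0 \<le> a" "0 \<le> l"
  shows "distribution_function M (\<lambda>x. f x - truncation a f x) l = distribution_function M f (a + l)"
proof -
  have "ereal l < max 0 (\<bar>y\<bar> - ereal a) \<longleftrightarrow> ereal (a + l) < \<bar>y\<bar>" for y
    using assms by (cases y) (auto simp: max_def)
  then show ?thesis
    unfolding distribution_function_def abs_minus_truncation[OF \<open>0 \<le> a\<close>] by simp
qed

lemma rearrangement_truncation_le:
  assumes [measurable]: "f \<in> borel_measurable M" and "0 \<le> a"
  shows "rearrangement M (truncation a f) t \<le> min (ereal a) (rearrangement M f t)"
proof (rule min.boundedI)
  have "distribution_function M (truncation a f) a = 0"
    unfolding distribution_function_def abs_truncation[OF \<open>0 \<le> a\<close>] by simp
  then show "rearrangement M (truncation a f) t \<le> ereal a"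
    using \<open>0 \<le> a\<close> by (simp add: rearrangement_le_iff)
  show "rearrangement M (truncation a f) t \<le> rearrangement M f t"
    by (intro rearrangement_mono) (simp_all add: abs_truncation \<open>0 \<le> a\<close>)
qed

lemma rearrangement_minus_truncation_le:
  assumes [measurable]: "f \<in> borel_measurable M" and "0 \<le> a"
  shows "rearrangement M (\<lambda>x. f x - truncation a f x) t \<le> rearrangement M f t"
proof (rule rearrangement_mono)
  have "max 0 (\<bar>y\<bar> - ereal a) \<le> \<bar>y\<bar>" for y using \<open>0 \<le> a\<close> by (cases y) auto
  then show "AE x in M. \<bar>f x - truncation a f x\<bar> \<le> \<bar>f x\<bar>"
    using \<open>0 \<le> a\<close> by (simp add: abs_minus_truncation)
qed simp

lemma rearrangement_minus_truncation_eq_0: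
  assumes [measurable]: "f \<in> borel_measurable M" and "0 \<le> a" "rearrangement M f t \<le> ereal a"
  shows "rearrangement M (\<lambda>x. f x - truncation a f x) t = 0"
proof (rule antisym)
  have "distribution_function M (\<lambda>x. f x - truncation a f x) 0 \<le> ennreal t"
    using assms by (simp add: distribution_function_minus_truncation rearrangement_le_iff)
  then show "rearrangement M (\<lambda>x. f x - truncation a f x) t \<le> 0"
    unfolding zero_ereal_def by (subst rearrangement_le_iff) auto
qed (rule rearrangement_nonneg)

section \<open>Dilations of the half-line\<close>

abbreviation half_line :: "real measure" where
  "half_line \<equiv> lebesgue_on {0<..}"

lemma borel_measurable_half_line:
  "g \<in> borel_measurable borel \<Longrightarrow> g \<in> borel_measurable half_line"
  by (intro measurable_restrict_space1 measurable_completion) simp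

lemma distribution_function_half_line:
  "distribution_function half_line f l = emeasure lebesgue {s. 0 < s \<and> ereal l < \<bar>f s\<bar>}"
  unfolding distribution_function_def by (subst emeasure_restrict_space) auto

lemma distribution_function_dilation:
  assumes "0 < a"
  shows "distribution_function half_line (\<lambda>s. f (s / a)) l
    = ennreal a * distribution_function half_line f l"
proof -
  have "{s. 0 < s \<and> ereal l < \<bar>f (s / a)\<bar>} = (\<lambda>s. a *\<^sub>R s + 0) ` {s. 0 < s \<and> ereal l < \<bar>f s\<bar>}"
    using \<open>0 < a\<close> by (auto simp: image_iff intro!: exI[of _ "_ / a"] divide_pos_pos)
  then show ?thesis
    unfolding distribution_function_half_line using \<open>0 < a\<close>
    by (simp only: emeasure_lebesgue_affine) simp
qed

lemma emeasure_lebesgue_piecewise_translation: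
  fixes P :: "'i::countable \<Rightarrow> 'a::euclidean_space set"
  assumes P: "\<And>k. P k \<in> sets lebesgue"
    and disjoint: "disjoint_family P" "disjoint_family (\<lambda>k. (+) (c k) ` P k)"
  shows "emeasure lebesgue (\<Union>k. (+) (c k) ` P k) = emeasure lebesgue (\<Union>k. P k)"
proof -
  have "emeasure lebesgue ((+) (c k) ` P k) = emeasure lebesgue (P k)" for k
    using emeasure_lebesgue_affine[of 1 "c k" "P k"] by (simp add: add.commute)
  then show ?thesis
    using P disjoint by (simp add: emeasure_UN_countable lebesgue_sets_translation)
qed

text \<open>Both \<open>(2k, 2k + 1]\<close> and \<open>(2k + 1, 2k + 2]\<close> are translated onto \<open>(k, k + 1]\<close>.\<close>

definition double_cover :: "real \<Rightarrow> real" where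
  "double_cover s = s - real_of_int (\<lceil>s\<rceil> div 2)"

lemma borel_measurable_double_cover [measurable]: "double_cover \<in> borel_measurable borel"
  unfolding double_cover_def by measurable

lemma ceiling_double_cover: "\<lceil>double_cover s\<rceil> = \<lceil>s\<rceil> - \<lceil>s\<rceil> div 2"
  unfolding double_cover_def by simp

lemma double_cover_pos_iff: "0 < double_cover s \<longleftrightarrow> 0 < s"
proof -
  have "0 < \<lceil>s\<rceil> - \<lceil>s\<rceil> div 2 \<longleftrightarrow> 0 < \<lceil>s\<rceil>" by presburger
  then show ?thesis using ceiling_double_cover[of s] by (metis zero_less_ceiling)
qed

lemma emeasure_double_cover_vimage:
  assumes S: "S \<in> sets lebesgue" and i: "i = 0 \<or> i = (1::int)"
  shows "emeasure lebesgue {s. \<lceil>s\<rceil> mod 2 = i \<and> double_cover s \<in> S} = emeasure lebesgue S"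
proof -
  define P where "P k = S \<inter> {x. \<lceil>x\<rceil> = k}" for k
  define Q where "Q k = (+) (real_of_int (k - i)) ` P k" for k
  have "{x::real. \<lceil>x\<rceil> = k} \<in> sets lebesgue" for k
    by (intro sets_completionI_sets) measurable
  then have P: "P k \<in> sets lebesgue" for k unfolding P_def using S by blast
  have ceiling_Q: "\<lceil>s\<rceil> = 2 * k - i" if "s \<in> Q k" for s k
    using that unfolding P_def Q_def by (auto simp: add.commute simp del: of_int_diff)
  have "disjoint_family P" unfolding P_def disjoint_family_on_def by auto
  moreover have "disjoint_family Q" by (auto simp: disjoint_family_on_def dest!: ceiling_Q)
  moreover have "S = (\<Union>k. P k)" unfolding P_def by auto
  moreover have "{s. \<lceil>s\<rceil> mod 2 = i \<and> double_cover s \<in> S} = (\<Union>k. Q k)"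
  proof (intro set_eqI iffI)
    fix s assume s: "s \<in> {s. \<lceil>s\<rceil> mod 2 = i \<and> double_cover s \<in> S}"
    then have "\<lceil>s\<rceil> div 2 = \<lceil>double_cover s\<rceil> - i"
      using mult_div_mod_eq[of 2 "\<lceil>s\<rceil>"] by (simp add: ceiling_double_cover)
    then have "s = real_of_int (\<lceil>double_cover s\<rceil> - i) + double_cover s"
      unfolding double_cover_def by simp
    then show "s \<in> (\<Union>k. Q k)" unfolding P_def Q_def using s by blast
  next
    fix s assume "s \<in> (\<Union>k. Q k)"
    then obtain k where k: "s \<in> Q k" by blast
    then have "s - real_of_int (k - i) \<in> S"
      unfolding P_def Q_def by (auto simp del: of_int_diff)
    moreover have "\<lceil>s\<rceil> div 2 = k - i" "\<lceil>s\<rceil> mod 2 = i"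
      using i by (simp_all only: ceiling_Q[OF k]) presburger+
    ultimately show "s \<in> {s. \<lceil>s\<rceil> mod 2 = i \<and> double_cover s \<in> S}"
      unfolding double_cover_def by simp
  qed
  ultimately show ?thesis
    using emeasure_lebesgue_piecewise_translation[OF P] unfolding Q_def by simp
qed

definition double_cover_pullback :: "int \<Rightarrow> (real \<Rightarrow> ereal) \<Rightarrow> real \<Rightarrow> ereal" where
  "double_cover_pullback i g s = (if \<lceil>s\<rceil> mod 2 = i then g (double_cover s) else 0)"

lemma borel_measurable_double_cover_pullback [measurable]:
  assumes [measurable]: "g \<in> borel_measurable borel"
  shows "double_cover_pullback i g \<in> borel_measurable borel"
  unfolding double_cover_pullback_def by measurable

lemma distribution_function_double_cover_pullback:
  assumes [measurable]: "g \<in> borel_measurable borel" and i: "i = 0 \<or> i = 1" and "0 \<le> l"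
  shows "distribution_function half_line (double_cover_pullback i g) l
    = distribution_function half_line g l"
proof -
  let ?S = "{s. 0 < s \<and> ereal l < \<bar>g s\<bar>}"
  have "?S \<in> sets lebesgue" by (intro sets_completionI_sets) measurable
  moreover have "{s. 0 < s \<and> ereal l < \<bar>double_cover_pullback i g s\<bar>}
      = {s. \<lceil>s\<rceil> mod 2 = i \<and> double_cover s \<in> ?S}"
    unfolding double_cover_pullback_def using \<open>0 \<le> l\<close> by (auto simp: double_cover_pos_iff)
  ultimately show ?thesis
    unfolding distribution_function_half_line by (simp only: emeasure_double_cover_vimage[OF _ i])
qed

lemma distribution_function_dilation_eq_double_cover_pullback:
  assumes g: "g \<in> borel_measurable borel" and "0 \<le> l"
  shows "distribution_function half_line (\<lambda>s. g (s / 2)) l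
    = distribution_function half_line
        (\<lambda>s. double_cover_pullback 0 g s + double_cover_pullback 1 g s) l"
    (is "_ = distribution_function _ (\<lambda>s. ?h0 s + ?h1 s) l")
proof -
  have "distribution_function half_line (\<lambda>s. ?h0 s + ?h1 s) l
    = distribution_function half_line ?h0 l + distribution_function half_line ?h1 l"
    using \<open>0 \<le> l\<close> g
    by (intro distribution_function_add_disjoint borel_measurable_half_line
        borel_measurable_double_cover_pullback) (auto simp: double_cover_pullback_def)
  also have "\<dots> = ennreal 2 * distribution_function half_line g l"
    using assms by (simp add: distribution_function_double_cover_pullback mult_2)
  also have "\<dots> = distribution_function half_line (\<lambda>s. g (s / 2)) l"
    by (rule distribution_function_dilation[symmetric]) simp
  finally show ?thesis ..
qed

section \<open>Quasi-Banach function norms\<close>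

lemma indicator_nonneg_measurable: "E \<in> sets M \<Longrightarrow> indicator E \<in> nonneg_measurable M"
  unfolding nonneg_measurable_def by auto

locale quasi_banach_norm =
  fixes M :: "'a measure" and N :: "('a \<Rightarrow> ereal) \<Rightarrow> ennreal"
  assumes quasi_banach: "quasi_banach_function_norm M N"
begin

lemma quasi_norm_mult: "f \<in> nonneg_measurable M \<Longrightarrow> 0 \<le> a \<Longrightarrow> N (\<lambda>x. ereal a * f x) = ennreal a * N f"
  using quasi_banach unfolding quasi_banach_function_norm_def by meson

lemma quasi_norm_eq_0_iff: "f \<in> nonneg_measurable M \<Longrightarrow> N f = 0 \<longleftrightarrow> (AE x in M. f x = 0)"
  using quasi_banach unfolding quasi_banach_function_norm_def by meson

lemma quasi_norm_mono:
  "f \<in> nonneg_measurable M \<Longrightarrow> g \<in> nonneg_measurable M \<Longrightarrow> AE x in M. f x \<le> g x \<Longrightarrow> N f \<le> N g"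
  using quasi_banach unfolding quasi_banach_function_norm_def by meson

lemma quasi_norm_indicator_finite: "E \<in> sets M \<Longrightarrow> emeasure M E < \<infinity> \<Longrightarrow> N (indicator E) < \<infinity>"
  using quasi_banach unfolding quasi_banach_function_norm_def by meson

definition concavity_constant :: real where
  "concavity_constant = (SOME C. 0 < C \<and> (\<forall>f\<in>nonneg_measurable M. \<forall>g\<in>nonneg_measurable M.
     N (\<lambda>x. f x + g x) \<le> ennreal C * (N f + N g)))"

lemma concavity_constant_pos: "0 < concavity_constant"
  and quasi_norm_add_le: "f \<in> nonneg_measurable M \<Longrightarrow> g \<in> nonneg_measurable M \<Longrightarrow>
    N (\<lambda>x. f x + g x) \<le> ennreal concavity_constant * (N f + N g)"
proof -
  have "\<exists>C. 0 < C \<and> (\<forall>f\<in>nonneg_measurable M. \<forall>g\<in>nonneg_measurable M.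
      N (\<lambda>x. f x + g x) \<le> ennreal C * (N f + N g))"
    using quasi_banach unfolding quasi_banach_function_norm_def by meson
  note C = someI_ex[OF this, folded concavity_constant_def]
  show "0 < concavity_constant" using C by blast
  show "N (\<lambda>x. f x + g x) \<le> ennreal concavity_constant * (N f + N g)"
    if "f \<in> nonneg_measurable M" "g \<in> nonneg_measurable M"
    using C that by blast
qed

lemma quasi_norm_indicator_eq_0_iff:
  assumes "E \<in> sets M"
  shows "N (indicator E) = 0 \<longleftrightarrow> emeasure M E = 0"
proof -
  have "N (indicator E) = 0 \<longleftrightarrow> (AE x in M. x \<notin> E)"
    using quasi_norm_eq_0_iff[OF indicator_nonneg_measurable[OF assms]]
    by (simp add: indicator_eq_0_iff)
  also have "\<dots> \<longleftrightarrow> emeasure M E = 0"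
    using AE_iff_null_sets[OF assms] assms by (simp add: null_sets_def)
  finally show ?thesis .
qed

end

locale ri_quasi_banach_norm =
  fixes M :: "'a measure" and N :: "('a \<Rightarrow> ereal) \<Rightarrow> ennreal"
  assumes ri_quasi_banach: "ri_quasi_banach_function_norm M N"

sublocale ri_quasi_banach_norm \<subseteq> quasi_banach_norm
  using ri_quasi_banach unfolding ri_quasi_banach_function_norm_def
  by unfold_locales (rule conjunct1)

lemma (in ri_quasi_banach_norm) quasi_norm_cong_distribution_function:
  assumes "f \<in> borel_measurable M" "g \<in> borel_measurable M"
    and "\<And>l. 0 \<le> l \<Longrightarrow> distribution_function M f l = distribution_function M g l"
  shows "N f = N g"
proof -
  have "\<forall>t>0. rearrangement M f t = rearrangement M g t"
    using rearrangement_cong[OF assms(3)] by simp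
  then show ?thesis
    using ri_quasi_banach[unfolded ri_quasi_banach_function_norm_def, THEN conjunct2] assms(1,2)
    by blast
qed

section \<open>Rearrangement-invariant norms on the half-line\<close>

abbreviation cutoff :: "'a set \<Rightarrow> ('a \<Rightarrow> ereal) \<Rightarrow> 'a \<Rightarrow> ereal" where
  "cutoff I g \<equiv> \<lambda>s. indicator I s * g s"

lemma nonneg_measurable_half_lineI:
  assumes "g \<in> borel_measurable borel" "\<And>s. 0 < s \<Longrightarrow> 0 \<le> g s"
  shows "g \<in> nonneg_measurable half_line"
  using assms unfolding nonneg_measurable_def by (simp add: borel_measurable_half_line)

lemma nonneg_measurable_half_line_rearrangement:
  "rearrangement M f \<in> nonneg_measurable half_line"
  by (intro nonneg_measurable_half_lineI rearrangement_nonneg) measurable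

lemma nonneg_measurable_half_line_cutoff_rearrangement:
  "I \<in> sets borel \<Longrightarrow> cutoff I (\<lambda>s. rearrangement M f (s / c)) \<in> nonneg_measurable half_line"
  by (intro nonneg_measurable_half_lineI) (auto simp: indicator_def rearrangement_nonneg)

lemma interval_in_half_line: "{0<..<t} \<in> sets half_line"
  by (simp add: sets_restrict_space_iff) auto

lemma emeasure_half_line_interval: "0 \<le> t \<Longrightarrow> emeasure half_line {0<..<t} = ennreal t"
  by (subst emeasure_restrict_space) auto

lemma AE_half_line_neq: "AE s in half_line. s \<noteq> t"
  by (subst AE_restrict_space_iff)
     (auto intro!: AE_completion eventually_mono[OF AE_lborel_singleton[of t]])

locale ri_half_line_norm = ri_quasi_banach_norm half_line R
  for R :: "(real \<Rightarrow> ereal) \<Rightarrow> ennreal"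
begin

lemma fundamental_function_pos: "0 < t \<Longrightarrow> 0 < fundamental_function R t"
  unfolding fundamental_function_def zero_less_iff_neq_zero
  by (simp add: quasi_norm_indicator_eq_0_iff[OF interval_in_half_line] emeasure_half_line_interval)

lemma fundamental_function_finite: "0 \<le> t \<Longrightarrow> fundamental_function R t < \<infinity>"
  unfolding fundamental_function_def
  by (intro quasi_norm_indicator_finite interval_in_half_line)
     (simp add: emeasure_half_line_interval)

lemma quasi_norm_scaled_indicator_interval:
  assumes "0 \<le> a"
  shows "R (\<lambda>s. ereal a * indicator {0<..<t} s) = ennreal a * fundamental_function R t"
  unfolding fundamental_function_def
  using assms by (intro quasi_norm_mult indicator_nonneg_measurable interval_in_half_line)

lemma e2ennreal_mult_fundamental_function_le:
  assumes g [measurable]: "g \<in> borel_measurable borel"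
    and le: "\<And>s. 0 < s \<Longrightarrow> s < t \<Longrightarrow> a \<le> g s" and "0 \<le> a"
  shows "e2ennreal a * fundamental_function R t \<le> R (cutoff {0<..<t} g)"
proof -
  have finite_level: "ennreal b * fundamental_function R t \<le> R (cutoff {0<..<t} g)"
    if b: "0 \<le> b" "ereal b \<le> a" for b
  proof -
    have "R (\<lambda>s. ereal b * indicator {0<..<t} s) \<le> R (cutoff {0<..<t} g)"
      using b le order_trans[OF \<open>0 \<le> a\<close> le]
      by (intro quasi_norm_mono nonneg_measurable_half_lineI AE_I2)
         (auto simp: indicator_def intro: order_trans)
    then show ?thesis using b by (simp add: quasi_norm_scaled_indicator_interval)
  qed
  show ?thesis
  proof (cases a)
    case (real r)
    then show ?thesis using finite_level[of r] \<open>0 \<le> a\<close> by simp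
  next
    case PInf
    have "(SUP n. of_nat n * fundamental_function R t) \<le> R (cutoff {0<..<t} g)"
      using finite_level[of "real _"] PInf
      by (intro SUP_least) (simp flip: ennreal_of_nat_eq_real_of_nat)
    then show ?thesis
      using PInf by (simp flip: SUP_mult_right_ennreal add: ennreal_SUP_of_nat_eq_top)
  qed (use \<open>0 \<le> a\<close> in simp)
qed

lemma rearrangement_finite:
  assumes "0 < t" "R (cutoff {0<..<t} (rearrangement M f)) < \<infinity>"
  shows "rearrangement M f t < \<infinity>"
proof -
  have "e2ennreal (rearrangement M f t) * fundamental_function R t
      \<le> R (cutoff {0<..<t} (rearrangement M f))"
    by (intro e2ennreal_mult_fundamental_function_le rearrangement_nonneg)
       (auto intro: antimonoD[OF rearrangement_antimono])
  also note assms(2)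
  finally show ?thesis
    using fundamental_function_pos[OF \<open>0 < t\<close>] by (auto simp: ennreal_top_mult split: if_splits)
qed

lemma quasi_norm_dilation_le:
  assumes g [measurable]: "g \<in> borel_measurable borel" and nonneg: "\<And>s. 0 < s \<Longrightarrow> 0 \<le> g s"
  shows "R (\<lambda>s. g (s / 2)) \<le> ennreal (2 * concavity_constant) * R g"
proof -
  let ?h = "\<lambda>i. double_cover_pullback i g"
  have "R (\<lambda>s. g (s / 2)) = R (\<lambda>s. ?h 0 s + ?h 1 s)"
    by (intro quasi_norm_cong_distribution_function borel_measurable_half_line
        distribution_function_dilation_eq_double_cover_pullback) auto
  also have "\<dots> \<le> ennreal concavity_constant * (R (?h 0) + R (?h 1))"
    by (intro quasi_norm_add_le nonneg_measurable_half_lineI)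
       (auto simp: double_cover_pullback_def nonneg double_cover_pos_iff)
  also have "R (?h i) = R g" if "i = 0 \<or> i = 1" for i
    using that g by (intro quasi_norm_cong_distribution_function borel_measurable_half_line
        distribution_function_double_cover_pullback) auto
  then have "R (?h 0) + R (?h 1) = 2 * R g" by (simp add: mult_2)
  also have "ennreal concavity_constant * (2 * R g) = ennreal (2 * concavity_constant) * R g"
    using concavity_constant_pos by (simp add: ennreal_mult mult_ac)
  finally show ?thesis .
qed

lemma quasi_norm_cutoff_dilated_rearrangement_le:
  assumes "I \<in> sets borel"
  shows "R (cutoff I (\<lambda>s. rearrangement M f (s / 2)))
    \<le> ennreal (2 * concavity_constant) * R (rearrangement M f)"
proof -
  have "R (cutoff I (\<lambda>s. rearrangement M f (s / 2))) \<le> R (\<lambda>s. rearrangement M f (s / 2))"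
    using assms
    by (intro quasi_norm_mono nonneg_measurable_half_line_cutoff_rearrangement
        nonneg_measurable_half_lineI AE_I2)
       (auto simp: indicator_def rearrangement_nonneg)
  also have "\<dots> \<le> ennreal (2 * concavity_constant) * R (rearrangement M f)"
    by (intro quasi_norm_dilation_le rearrangement_nonneg) measurable
  finally show ?thesis .
qed

lemma quasi_norm_cutoff_rearrangement_add_le:
  assumes I: "I \<in> sets borel"
    and meas: "f \<in> borel_measurable M" "g \<in> borel_measurable M" "h \<in> borel_measurable M"
    and sum: "AE x in M. f x = g x + h x"
  shows "R (cutoff I (rearrangement M f)) \<le> ennreal concavity_constant *
    (R (cutoff I (\<lambda>s. rearrangement M g (s / 2))) + R (cutoff I (\<lambda>s. rearrangement M h (s / 2))))"
proof -
  let ?g = "cutoff I (\<lambda>s. rearrangement M g (s / 2))"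
    and ?h = "cutoff I (\<lambda>s. rearrangement M h (s / 2))"
  have "cutoff I (rearrangement M f) s \<le> ?g s + ?h s" if "0 < s" for s
    using rearrangement_add_le[OF meas sum, of "s / 2" "s / 2"] that by (simp add: indicator_def)
  then have "R (cutoff I (rearrangement M f)) \<le> R (\<lambda>s. ?g s + ?h s)"
    using I
    by (intro quasi_norm_mono nonneg_measurable_half_lineI AE_I2)
       (auto simp: indicator_def rearrangement_nonneg)
  also have "\<dots> \<le> ennreal concavity_constant * (R ?g + R ?h)"
    by (intro quasi_norm_add_le nonneg_measurable_half_line_cutoff_rearrangement I)
  finally show ?thesis .
qed

lemma quasi_norm_rearrangement_minus_truncation_le:
  assumes f [measurable]: "f \<in> borel_measurable M" and a: "rearrangement M f t = ereal a"
  shows "R (rearrangement M (\<lambda>x. f x - truncation a f x)) \<le> R (cutoff {0<..<t} (rearrangement M f))"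
proof -
  have "0 \<le> a" using rearrangement_nonneg[of M f t] a by simp
  have "rearrangement M (\<lambda>x. f x - truncation a f x) s \<le> cutoff {0<..<t} (rearrangement M f) s"
    if "0 < s" for s
  proof (cases "s < t")
    case True
    then show ?thesis using rearrangement_minus_truncation_le[OF f \<open>0 \<le> a\<close>] \<open>0 < s\<close> by simp
  next
    case False
    then have "rearrangement M f s \<le> ereal a"
      using antimonoD[OF rearrangement_antimono, of t s M f] a by simp
    then show ?thesis using rearrangement_minus_truncation_eq_0[OF f \<open>0 \<le> a\<close>] False by simp
  qed
  then show ?thesis
    using nonneg_measurable_half_line_cutoff_rearrangement[of "{0<..<t}" M f 1]
    by (intro quasi_norm_mono nonneg_measurable_half_line_rearrangement AE_I2) auto
qed

lemma quasi_norm_rearrangement_truncation_le: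
  assumes f [measurable]: "f \<in> borel_measurable M" and "0 \<le> a"
  shows "R (rearrangement M (truncation a f)) \<le> ennreal concavity_constant *
    (ennreal a * fundamental_function R t + R (cutoff {t<..} (rearrangement M f)))"
proof -
  let ?u = "\<lambda>s. ereal a * indicator {0<..<t} s" and ?v = "cutoff {t<..} (rearrangement M f)"
  have "AE s in half_line. rearrangement M (truncation a f) s \<le> ?u s + ?v s"
    using AE_half_line_neq[of t] AE_space
  proof eventually_elim
    case (elim s)
    then show ?case
      using rearrangement_truncation_le[OF f \<open>0 \<le> a\<close>, of s] by (cases s t rule: linorder_cases) auto
  qed
  then have "R (rearrangement M (truncation a f)) \<le> R (\<lambda>s. ?u s + ?v s)"
    using \<open>0 \<le> a\<close>
    by (intro quasi_norm_mono nonneg_measurable_half_line_rearrangement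
        nonneg_measurable_half_lineI)
       (auto simp: indicator_def rearrangement_nonneg)
  also have "\<dots> \<le> ennreal concavity_constant * (R ?u + R ?v)"
    using \<open>0 \<le> a\<close> by (intro quasi_norm_add_le nonneg_measurable_half_lineI)
       (auto simp: indicator_def rearrangement_nonneg)
  finally show ?thesis using \<open>0 \<le> a\<close> by (simp add: quasi_norm_scaled_indicator_interval)
qed

text \<open>In the application \<open>B\<close> is the weighted norm of \<open>h\<close> in the other space of the couple.\<close>

lemma weighted_quasi_norm_cutoff_rearrangement_le:
  assumes I: "I \<in> sets borel"
    and meas: "f \<in> borel_measurable M" "g \<in> borel_measurable M" "h \<in> borel_measurable M"
    and sum: "AE x in M. f x = g x + h x"
    and cross: "w * R (cutoff I (\<lambda>s. rearrangement M h (s / 2))) \<le> ennreal c * B" and "0 \<le> c"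
  shows "w * R (cutoff I (rearrangement M f))
    \<le> ennreal (concavity_constant * (2 * concavity_constant + c)) * (w * R (rearrangement M g) + B)"
proof -
  let ?C = concavity_constant
  have "w * R (cutoff I (rearrangement M f)) \<le> w * (ennreal ?C *
    (R (cutoff I (\<lambda>s. rearrangement M g (s / 2))) + R (cutoff I (\<lambda>s. rearrangement M h (s / 2)))))"
    by (intro mult_left_mono quasi_norm_cutoff_rearrangement_add_le[OF I meas sum]) simp
  also have "\<dots> = ennreal ?C * (w * R (cutoff I (\<lambda>s. rearrangement M g (s / 2)))
    + w * R (cutoff I (\<lambda>s. rearrangement M h (s / 2))))"
    by (simp add: distrib_left mult_ac)
  also have "\<dots> \<le> ennreal ?C * (w * (ennreal (2 * ?C) * R (rearrangement M g)) + ennreal c * B)"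
    by (intro mult_left_mono add_mono quasi_norm_cutoff_dilated_rearrangement_le[OF I] cross) auto
  also have "\<dots> = ennreal ?C * (ennreal (2 * ?C) * (w * R (rearrangement M g)) + ennreal c * B)"
    by (simp add: mult_ac)
  also have "\<dots> \<le> ennreal ?C * (ennreal (2 * ?C + c) * (w * R (rearrangement M g))
    + ennreal (2 * ?C + c) * B)"
    using concavity_constant_pos \<open>0 \<le> c\<close>
    by (intro mult_left_mono add_mono mult_right_mono ennreal_leI) auto
  also have "\<dots> = ennreal (?C * (2 * ?C + c)) * (w * R (rearrangement M g) + B)"
    using concavity_constant_pos \<open>0 \<le> c\<close>
    by (subst ennreal_mult) (simp_all add: distrib_left mult.assoc del: ennreal_plus)
  finally show ?thesis .
qed

end

section \<open>The K-functional\<close>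

lemma K_functional_le:
  "(f0, f1) \<in> decompositions M N0 N1 f \<Longrightarrow> K_functional M N0 N1 f w \<le> N0 f0 + w * N1 f1"
  unfolding K_functional_def by (rule INF_lower2) auto

lemma le_mult_K_functional:
  assumes "0 < c"
    and "\<And>f0 f1. (f0, f1) \<in> decompositions M N0 N1 f \<Longrightarrow>
      L \<le> ennreal c * (N0 f0 + w * N1 f1)"
  shows "L \<le> ennreal c * K_functional M N0 N1 f w"
proof -
  have "L / ennreal c \<le> K_functional M N0 N1 f w"
    unfolding K_functional_def
    by (rule INF_greatest) (use assms in \<open>auto intro!: divide_le_posI_ennreal\<close>)
  then have "ennreal c * (L / ennreal c) \<le> ennreal c * K_functional M N0 N1 f w"
    by (rule mult_left_mono) simp
  moreover have "ennreal c * (L / ennreal c) = L"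
    using \<open>0 < c\<close> mult_divide_eq_ennreal[of "ennreal c" L]
    by (simp add: ennreal_times_divide mult.commute)
  ultimately show ?thesis by simp
qed

locale represented_couple =
  fixes M :: "'a measure" and A0 A1 :: "('a \<Rightarrow> ereal) \<Rightarrow> ennreal"
    and R0 R1 :: "(real \<Rightarrow> ereal) \<Rightarrow> ennreal"
  assumes representation0: "representation_norm M A0 R0"
    and representation1: "representation_norm M A1 R1"

sublocale represented_couple \<subseteq> R0: ri_half_line_norm R0
  using representation0 unfolding representation_norm_def by unfold_locales (rule conjunct1)

sublocale represented_couple \<subseteq> R1: ri_half_line_norm R1
  using representation1 unfolding representation_norm_def by unfold_locales (rule conjunct1)

context represented_couple
begin

lemma A0_eq: "f \<in> borel_measurable M \<Longrightarrow> A0 f = R0 (rearrangement M f)"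
  using representation0 unfolding representation_norm_def by meson

lemma A1_eq: "f \<in> borel_measurable M \<Longrightarrow> A1 f = R1 (rearrangement M f)"
  using representation1 unfolding representation_norm_def by meson

definition split_norm :: "real \<Rightarrow> ennreal \<Rightarrow> ('a \<Rightarrow> ereal) \<Rightarrow> ennreal" where
  "split_norm t w f =
    R0 (cutoff {0<..<t} (rearrangement M f)) + w * R1 (cutoff {t<..} (rearrangement M f))"

lemma
  assumes "0 < t" "w = fundamental_function R0 t / fundamental_function R1 t"
  shows fundamental_ratio_neq_0: "w \<noteq> 0"
    and fundamental_ratio_mult: "w * fundamental_function R1 t = fundamental_function R0 t"
  using R0.fundamental_function_pos[of t] R0.fundamental_function_finite[of t]
    R1.fundamental_function_pos[of t] R1.fundamental_function_finite[of t] assms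
  by (auto simp: less_top[symmetric] ennreal_divide_eq_top_iff ennreal_divide_times)

lemma truncation_decomposition:
  assumes f [measurable]: "f \<in> borel_measurable M" and "0 < t"
    and a: "rearrangement M f t = ereal a"
    and finite: "R0 (cutoff {0<..<t} (rearrangement M f)) < \<infinity>"
      "R1 (cutoff {t<..} (rearrangement M f)) < \<infinity>"
  shows "(\<lambda>x. f x - truncation a f x, truncation a f) \<in> decompositions M A0 A1 f"
proof -
  have "0 \<le> a" using rearrangement_nonneg[of M f t] a by simp
  have "A0 (\<lambda>x. f x - truncation a f x) < \<infinity>"
    using R0.quasi_norm_rearrangement_minus_truncation_le[OF f a] finite(1) by (simp add: A0_eq)
  moreover have "A1 (truncation a f) < \<infinity>"
  proof -
    have "ennreal a * fundamental_function R1 t < \<infinity>"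
      using R1.fundamental_function_finite[of t] \<open>0 < t\<close> by (simp add: ennreal_mult_less_top)
    then show ?thesis
      using R1.quasi_norm_rearrangement_truncation_le[OF f \<open>0 \<le> a\<close>, of t] finite(2)
      by (auto simp: A1_eq ennreal_mult_less_top intro: le_less_trans)
  qed
  ultimately show ?thesis
    unfolding decompositions_def function_space_def by (simp add: minus_truncation_add)
qed

lemma K_functional_le_split_norm_of_finite:
  assumes f [measurable]: "f \<in> borel_measurable M" and "0 < t"
    and w: "w = fundamental_function R0 t / fundamental_function R1 t"
    and finite: "R0 (cutoff {0<..<t} (rearrangement M f)) < \<infinity>"
      "R1 (cutoff {t<..} (rearrangement M f)) < \<infinity>"
  shows "K_functional M A0 A1 f w \<le> ennreal (1 + R1.concavity_constant) * split_norm t w f"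
proof -
  let ?C = R1.concavity_constant
  let ?X = "R0 (cutoff {0<..<t} (rearrangement M f))"
    and ?Y = "R1 (cutoff {t<..} (rearrangement M f))"
  obtain a where a: "rearrangement M f t = ereal a" "0 \<le> a"
    using R0.rearrangement_finite[OF \<open>0 < t\<close> finite(1)] rearrangement_nonneg[of M f t]
    by (cases "rearrangement M f t") auto
  have level: "ennreal a * fundamental_function R0 t \<le> ?X"
    using R0.e2ennreal_mult_fundamental_function_le[of "rearrangement M f" t "ereal a"] a
      antimonoD[OF rearrangement_antimono, of _ t M f]
    by simp
  have "K_functional M A0 A1 f w \<le> A0 (\<lambda>x. f x - truncation a f x) + w * A1 (truncation a f)"
    by (intro K_functional_le truncation_decomposition[OF f \<open>0 < t\<close> a(1) finite])
  also have "\<dots> \<le> ?X + w * (ennreal ?C * (ennreal a * fundamental_function R1 t + ?Y))"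
    using R0.quasi_norm_rearrangement_minus_truncation_le[OF f a(1)]
      R1.quasi_norm_rearrangement_truncation_le[OF f a(2), of t]
    by (intro add_mono mult_left_mono) (simp_all add: A0_eq A1_eq)
  also have "\<dots> = ?X + ennreal ?C * (ennreal a * (w * fundamental_function R1 t))
    + ennreal ?C * (w * ?Y)"
    by (simp add: algebra_simps)
  also have "\<dots> \<le> ?X + ennreal ?C * ?X + ennreal (1 + ?C) * (w * ?Y)"
    unfolding fundamental_ratio_mult[OF \<open>0 < t\<close> w]
    by (intro add_mono mult_left_mono mult_right_mono level ennreal_leI) auto
  also have "\<dots> = ennreal (1 + ?C) * split_norm t w f"
    unfolding split_norm_def
    using R1.concavity_constant_pos by (simp add: algebra_simps ennreal_plus)
  finally show ?thesis .
qed

lemma K_functional_le_split_norm: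
  assumes f: "f \<in> borel_measurable M" and "0 < t"
    and w: "w = fundamental_function R0 t / fundamental_function R1 t"
  shows "K_functional M A0 A1 f w \<le> ennreal (1 + R1.concavity_constant) * split_norm t w f"
proof (cases "R0 (cutoff {0<..<t} (rearrangement M f)) < \<infinity>
    \<and> R1 (cutoff {t<..} (rearrangement M f)) < \<infinity>")
  case True
  then show ?thesis by (intro K_functional_le_split_norm_of_finite[OF f \<open>0 < t\<close> w]) auto
next
  case False
  then have "split_norm t w f = \<infinity>"
    unfolding split_norm_def using fundamental_ratio_neq_0[OF \<open>0 < t\<close> w]
    by (auto simp: ennreal_mult_eq_top_iff less_top[symmetric])
  then show ?thesis using R1.concavity_constant_pos by (simp add: ennreal_mult_eq_top_iff)
qed

definition lower_bound_constant :: "real \<Rightarrow> real \<Rightarrow> real" where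
  "lower_bound_constant c0 c1 = R0.concavity_constant * (2 * R0.concavity_constant + c0)
     + R1.concavity_constant * (2 * R1.concavity_constant + c1)"

lemma lower_bound_constant_pos: "0 \<le> c0 \<Longrightarrow> 0 \<le> c1 \<Longrightarrow> 0 < lower_bound_constant c0 c1"
  unfolding lower_bound_constant_def using R0.concavity_constant_pos R1.concavity_constant_pos
  by (simp add: add_pos_nonneg add_pos_pos)

lemma split_norm_le_K_functional:
  assumes f: "f \<in> borel_measurable M" and "0 \<le> c0" "0 \<le> c1"
    and R0_le: "\<And>g. g \<in> function_space M A1 \<Longrightarrow>
      R0 (cutoff {0<..<t} (\<lambda>s. rearrangement M g (s / 2)))
        \<le> ennreal c0 * (w * R1 (rearrangement M g))"
    and R1_le: "\<And>h. h \<in> function_space M A0 \<Longrightarrow>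
      w * R1 (cutoff {t<..} (\<lambda>s. rearrangement M h (s / 2)))
        \<le> ennreal c1 * R0 (rearrangement M h)"
  shows "split_norm t w f \<le> ennreal (lower_bound_constant c0 c1) * K_functional M A0 A1 f w"
proof (rule le_mult_K_functional)
  show "0 < lower_bound_constant c0 c1" by (rule lower_bound_constant_pos) fact+
  fix f0 f1 assume "(f0, f1) \<in> decompositions M A0 A1 f"
  then have f0: "f0 \<in> function_space M A0" "f0 \<in> borel_measurable M"
    and f1: "f1 \<in> function_space M A1" "f1 \<in> borel_measurable M"
    and sum: "AE x in M. f x = f0 x + f1 x" and sum_swap: "AE x in M. f x = f1 x + f0 x"
    unfolding decompositions_def function_space_def by (auto simp: add.commute)
  let ?S = "A0 f0 + w * A1 f1" and ?C0 = R0.concavity_constant and ?C1 = R1.concavity_constant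
  have "R0 (cutoff {0<..<t} (rearrangement M f)) \<le> ennreal (?C0 * (2 * ?C0 + c0)) * ?S"
    using R0.weighted_quasi_norm_cutoff_rearrangement_le[OF _ f f0(2) f1(2) sum, where w = 1]
      R0_le[OF f1(1)] \<open>0 \<le> c0\<close> by (simp add: A0_eq[OF f0(2)] A1_eq[OF f1(2)])
  moreover have "w * R1 (cutoff {t<..} (rearrangement M f)) \<le> ennreal (?C1 * (2 * ?C1 + c1)) * ?S"
    using R1.weighted_quasi_norm_cutoff_rearrangement_le[OF _ f f1(2) f0(2) sum_swap
        R1_le[OF f0(1)]]
      \<open>0 \<le> c1\<close> by (simp add: A0_eq[OF f0(2)] A1_eq[OF f1(2)] add.commute)
  ultimately have "split_norm t w f
      \<le> ennreal (?C0 * (2 * ?C0 + c0)) * ?S + ennreal (?C1 * (2 * ?C1 + c1)) * ?S"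
    unfolding split_norm_def by (rule add_mono)
  also have "\<dots> = ennreal (lower_bound_constant c0 c1) * ?S"
    unfolding lower_bound_constant_def
    using \<open>0 \<le> c0\<close> \<open>0 \<le> c1\<close> R0.concavity_constant_pos R1.concavity_constant_pos
    by (subst ennreal_plus) (auto simp: distrib_right)
  finally show "split_norm t w f \<le> ennreal (lower_bound_constant c0 c1) * ?S" .
qed

end

theorem theorem1p3:
  fixes M :: "'a measure"
    and A0 A1 :: "('a \<Rightarrow> ereal) \<Rightarrow> ennreal"
    and R0 R1 :: "(real \<Rightarrow> ereal) \<Rightarrow> ennreal"
    and \<sigma> :: "real \<Rightarrow> ennreal"
  assumes "sigma_finite_measure M" and "nonatomic M" and "0 < emeasure M (space M)"
    and "ri_quasi_banach_function_norm M A0" and "ri_quasi_banach_function_norm M A1"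
    and "representation_norm M A0 R0" and "representation_norm M A1 R1"
    and "\<And>t. 0 < t \<Longrightarrow> \<sigma> t = fundamental_function R0 t / fundamental_function R1 t"
    and "\<exists>c::real. 0 < c \<and> (\<forall>t>0. \<forall>g\<in>function_space M A1.
           R0 (\<lambda>s. indicator {0<..<t} s * rearrangement M g (s / 2))
             \<le> ennreal c * (\<sigma> t * R1 (rearrangement M g)))"
    and "\<exists>c::real. 0 < c \<and> (\<forall>t>0. \<forall>h\<in>function_space M A0.
           \<sigma> t * R1 (\<lambda>s. indicator {t<..} s * rearrangement M h (s / 2))
             \<le> ennreal c * R0 (rearrangement M h))"
  shows "\<exists>c C :: real. 0 < c \<and> 0 < C \<and> (\<forall>f\<in>sum_space M A0 A1. \<forall>t>0.
           K_functional M A0 A1 f (\<sigma> t)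
             \<le> ennreal C * (R0 (\<lambda>s. indicator {0<..<t} s * rearrangement M f s)
                 + \<sigma> t * R1 (\<lambda>s. indicator {t<..} s * rearrangement M f s)) \<and>
           R0 (\<lambda>s. indicator {0<..<t} s * rearrangement M f s)
                 + \<sigma> t * R1 (\<lambda>s. indicator {t<..} s * rearrangement M f s)
             \<le> ennreal c * K_functional M A0 A1 f (\<sigma> t))"
proof -
  interpret represented_couple M A0 A1 R0 R1
    using assms(6,7) by unfold_locales
  obtain c0 where c0: "0 < c0" "\<And>t g. 0 < t \<Longrightarrow> g \<in> function_space M A1 \<Longrightarrow>
      R0 (cutoff {0<..<t} (\<lambda>s. rearrangement M g (s / 2)))
        \<le> ennreal c0 * (\<sigma> t * R1 (rearrangement M g))"
    using assms(9) by blast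
  obtain c1 where c1: "0 < c1" "\<And>t h. 0 < t \<Longrightarrow> h \<in> function_space M A0 \<Longrightarrow>
      \<sigma> t * R1 (cutoff {t<..} (\<lambda>s. rearrangement M h (s / 2)))
        \<le> ennreal c1 * R0 (rearrangement M h)"
    using assms(10) by blast
  show ?thesis
    unfolding split_norm_def[symmetric]
  proof (intro exI conjI ballI allI impI)
    show "0 < lower_bound_constant c0 c1" "0 < 1 + R1.concavity_constant"
      using lower_bound_constant_pos c0(1) c1(1) R1.concavity_constant_pos
      by (simp_all add: less_imp_le)
    fix f t assume "f \<in> sum_space M A0 A1" and t: "0 < (t::real)"
    then have f: "f \<in> borel_measurable M" unfolding sum_space_def by simp
    show "K_functional M A0 A1 f (\<sigma> t) \<le> ennreal (1 + R1.concavity_constant) * split_norm t (\<sigma> t) f"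
      by (rule K_functional_le_split_norm[OF f t assms(8)[OF t]])
    show "split_norm t (\<sigma> t) f
        \<le> ennreal (lower_bound_constant c0 c1) * K_functional M A0 A1 f (\<sigma> t)"
      using f c0 c1 t by (intro split_norm_le_K_functional) auto
  qed
qed

end
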